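(* Let $k\in(4,\infty)$ and set $a=\sqrt{(4+k)/(4-k)}$, $c=k/\sqrt{4-k}$. Then $$\mathrm{m}(P_{1,k})=2\bigl(\mathrm{m}^{+}(P_{a,c})-\mathrm{m}^{-}(P_{a,c})\bigr)+\frac12\log\left(\frac{k-4}{k+4}\right).$$
   Context: For complex numbers $a\neq 0$ and $c$, let $P_{a,c}(x,y)=a\left(x+\frac1x\right)+y+\frac1y+c$; in particular $P_{1,k}(x,y)=x+\frac1x+y+\frac1y+k$. The (logarithmic) Mahler measure of a nonzero Laurent polynomial $P\in\mathbb{C}[x^{\pm1},y^{\pm1}]$ is $\mathrm{m}(P)=\int_0^1\int_0^1\log|P(e^{2\pi i\theta_1},e^{2\pi i\theta_2})|\,d\theta_1\,d\theta_2$. Half-Mahler measures: write $yP_{a,c}(x,y)=y^2+B(x)y+1=(y-y_+(x))(y-y_-(x))$, where $B(x)=a(x+1/x)+c$ and $y_{\pm}(x)=\frac{-B(x)\pm\sqrt{B(x)^2-4}}{2}$. Then $\mathrm{m}^{\pm}(P_{a,c})=\int_0^1\log^+|y_{\pm}(e^{2\pi i\theta})|\,d\theta$, where $\log^+(r)=\max\{0,\log r\}$. All square roots are principal branches, so that $\sqrt{-r}=i\sqrt{r}$ for $r>0$. Thus for $k>4$ one has $a=i\sqrt{(k+4)/(k-4)}$ and $c=-ik/\sqrt{k-4}$, and for $|x|=1$ the number $B(x)$ is purely imaginary and $\sqrt{B(x)^2-4}=i\sqrt{|B(x)|^2+4}$. *)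

theory Defs
  imports "HOL-Analysis.Analysis"
begin

text \<open>
  Laurent polynomials in two variables are represented by the functions they induce on pairs of
  nonzero complex numbers; only the values on the unit torus enter the Mahler measure.
\<close>

definition P :: "complex \<Rightarrow> complex \<Rightarrow> complex \<Rightarrow> complex \<Rightarrow> complex" where
  "P a c x y = a * (x + 1 / x) + y + 1 / y + c"

text \<open>
  The function \<open>cis (2 * pi * t)\<close> is \<open>e\<^sup>2\<^sup>\<pi>\<^sup>i\<^sup>t\<close>. The library's convention \<open>ln 0 = 0\<close> only affects
  the zero set on the torus, which is a null set for every nonzero Laurent polynomial.
\<close>

definition mahler_measure :: "(complex \<Rightarrow> complex \<Rightarrow> complex) \<Rightarrow> real" where
  "mahler_measure Q =
     (LBINT t2:{0..1}. (LBINT t1:{0..1}. ln (cmod (Q (cis (2 * pi * t1)) (cis (2 * pi * t2))))))"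

definition B :: "complex \<Rightarrow> complex \<Rightarrow> complex \<Rightarrow> complex" where
  "B a c x = a * (x + 1 / x) + c"

definition y_plus :: "complex \<Rightarrow> complex \<Rightarrow> complex \<Rightarrow> complex" where
  "y_plus a c x = (- B a c x + csqrt ((B a c x)\<^sup>2 - 4)) / 2"

definition y_minus :: "complex \<Rightarrow> complex \<Rightarrow> complex \<Rightarrow> complex" where
  "y_minus a c x = (- B a c x - csqrt ((B a c x)\<^sup>2 - 4)) / 2"

lemma P_factorization:
  assumes "y \<noteq> 0"
  shows "y * P a c x y = y\<^sup>2 + B a c x * y + 1"
    and "y * P a c x y = (y - y_plus a c x) * (y - y_minus a c x)"
proof -
  show *: "y * P a c x y = y\<^sup>2 + B a c x * y + 1"
    using assms unfolding P_def B_def by (simp add: algebra_simps power2_eq_square)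
  have "(csqrt ((B a c x)\<^sup>2 - 4))\<^sup>2 = (B a c x)\<^sup>2 - 4"
    by simp
  then show "y * P a c x y = (y - y_plus a c x) * (y - y_minus a c x)"
    unfolding * y_plus_def y_minus_def by (simp add: field_simps power2_eq_square)
qed

definition log_plus :: "real \<Rightarrow> real" where
  "log_plus r = max 0 (ln r)"

definition half_mahler_plus :: "complex \<Rightarrow> complex \<Rightarrow> real" where
  "half_mahler_plus a c = (LBINT t:{0..1}. log_plus (cmod (y_plus a c (cis (2 * pi * t)))))"

definition half_mahler_minus :: "complex \<Rightarrow> complex \<Rightarrow> real" where
  "half_mahler_minus a c = (LBINT t:{0..1}. log_plus (cmod (y_minus a c (cis (2 * pi * t)))))"

end

theory Submission
  imports Defs "HOL-Complex_Analysis.Complex_Analysis" "HOL-Real_Asymp.Real_Asymp"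
begin

text \<open>
  Put \<open>e = 2 / sqrt (k + 4)\<close>. Jensen's formula turns the Mahler measure into the mean of
  \<open>arcosh (2 / e\<^sup>2 - 2 + cos x)\<close>. The roots \<open>y\<^sub>\<plusminus>\<close> have modulus \<open>exp (\<plusminus> u)\<close> with
  \<open>u = arsinh ((1 / e - e - cos x) / sqrt (1 - 2 e\<^sup>2))\<close>, so the two half Mahler measures
  differ by the mean of \<open>u\<close>. Both sides are then differentiated in \<open>e\<close>. The first derivative is a
  complete elliptic integral of the first kind and the second one contains an integral of the third
  kind; Moebius substitutions in \<open>cos x\<close> bring both to the radicand
  \<open>1 - 2 e\<^sup>2 + e\<^sup>4 cos\<^sup>2 x\<close>. The pole of the third kind integral is at a torsion point of the
  elliptic curve, so that integral is the sum of a multiple of the first kind integral and an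
  elementary term. The derivatives therefore agree, and the difference of the two sides tends to
  \<open>0\<close> for \<open>e \<rightarrow> 0\<close>, that is for \<open>k \<rightarrow> \<infinity>\<close>.
\<close>

subsection \<open>Integrals of functions of the cosine\<close>

lemma integral_cos_reflect:
  fixes f :: "real \<Rightarrow> real"
  assumes f: "continuous_on {-1..1} f"
  shows "integral {0..pi} (\<lambda>x. f (- cos x)) = integral {0..pi} (\<lambda>x. f (cos x))"
proof -
  have "continuous_on {0..pi} (\<lambda>x. f (cos x))"
    by (rule continuous_on_compose2[OF f]) (auto intro!: continuous_intros)
  \<comment> \<open>Substituting pi - x reverses the orientation, so the general rule yields a
    difference of two integrals. The one over \<open>{pi - 0..pi - pi}\<close> has an empty domain;
    the other carries a minus sign.\<close>
  then have "((\<lambda>x. -1 *\<^sub>R f (cos (pi - x))) has_integral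
      (integral {pi - 0..pi - pi} (\<lambda>x. f (cos x)) - integral {pi - pi..pi - 0} (\<lambda>x. f (cos x)))) {0..pi}"
    by (intro has_integral_substitution_general[where s = "{}" and c = 0 and d = pi])
       (auto intro!: continuous_intros derivative_eq_intros)
  from has_integral_neg[OF this] show ?thesis
    by (simp add: integral_unique)
qed

text \<open>Bridge from the normalised angle of the Mahler measures to \<open>{0..pi}\<close>, where
  arccos inverts the cosine and substitutions in cos x become available.\<close>

lemma integral_cos_full_circle:
  fixes f :: "real \<Rightarrow> real"
  assumes f: "continuous_on {-1..1} f"
  shows "integral {0..1} (\<lambda>t. f (cos (2 * pi * t))) = integral {0..pi} (\<lambda>x. f (cos x)) / pi"
proof -
  let ?I = "integral {0..pi} (\<lambda>x. f (cos x))"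
  have F: "continuous_on {0..pi} (\<lambda>x. f (cos x))"
    by (rule continuous_on_compose2[OF f]) (auto intro!: continuous_intros)
  have "((\<lambda>t. (2 * pi) *\<^sub>R f (cos (2 * pi * t))) has_integral
      (integral {2 * pi * 0..2 * pi * (1/2)} (\<lambda>x. f (cos x)) -
       integral {2 * pi * (1/2)..2 * pi * 0} (\<lambda>x. f (cos x)))) {0..1/2}"
    by (intro has_integral_substitution_general[where s = "{}" and c = 0 and d = pi] F)
       (auto intro!: continuous_intros derivative_eq_intros)
  then have 1: "((\<lambda>t. 2 * pi * f (cos (2 * pi * t))) has_integral ?I) {0..1/2}"
    by simp
  \<comment> \<open>The second half of the circle is folded back by x = 2 pi - 2 pi t, which
    preserves the cosine.\<close>
  have "((\<lambda>t. (- (2 * pi)) *\<^sub>R f (cos (2 * pi - 2 * pi * t))) has_integral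
      (integral {2 * pi - 2 * pi * (1/2)..2 * pi - 2 * pi * 1} (\<lambda>x. f (cos x)) -
       integral {2 * pi - 2 * pi * 1..2 * pi - 2 * pi * (1/2)} (\<lambda>x. f (cos x)))) {1/2..1}"
    by (intro has_integral_substitution_general[where s = "{}" and c = 0 and d = pi] F)
       (auto intro!: continuous_intros derivative_eq_intros simp: field_simps)
  from has_integral_neg[OF this]
  have 2: "((\<lambda>t. 2 * pi * f (cos (2 * pi * t))) has_integral ?I) {1/2..1}"
    by (simp add: cos_diff)
  have "((\<lambda>t. 2 * pi * f (cos (2 * pi * t))) has_integral (?I + ?I)) {0..1}"
    by (rule has_integral_combine[OF _ _ 1 2]) auto
  from has_integral_mult_right[OF this, of "1 / (2 * pi)"] show ?thesis
    by (simp add: integral_unique)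
qed

text \<open>After scaling x = pi t the doubled angle runs once around the circle, so both sides are
  pi times the same mean.\<close>

lemma integral_cos_double:
  fixes f :: "real \<Rightarrow> real"
  assumes f: "continuous_on {-1..1} f"
  shows "integral {0..pi} (\<lambda>x. f (cos (2 * x))) = integral {0..pi} (\<lambda>x. f (cos x))"
proof -
  have F: "continuous_on {0..pi} (\<lambda>x. f (cos (2 * x)))"
    by (rule continuous_on_compose2[OF f]) (auto intro!: continuous_intros)
  have "((\<lambda>t. pi *\<^sub>R f (cos (2 * (pi * t)))) has_integral
      (integral {pi * 0..pi * 1} (\<lambda>x. f (cos (2 * x))))) {0..1}"
    by (intro has_integral_substitution[where c = 0 and d = pi] F)
       (auto intro!: continuous_intros derivative_eq_intros)
  from has_integral_mult_right[OF this, of "1 / pi"]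
  have "integral {0..1} (\<lambda>t. f (cos (2 * pi * t))) = integral {0..pi} (\<lambda>x. f (cos (2 * x))) / pi"
    by (simp add: integral_unique mult_ac)
  with integral_cos_full_circle[OF f] show ?thesis
    by simp
qed

lemma one_plus_mult_cos_pos:
  fixes q x :: real
  assumes "\<bar>q\<bar> < 1"
  shows "1 + q * cos x > 0"
proof -
  have "\<bar>q * cos x\<bar> \<le> \<bar>q\<bar> * 1"
    unfolding abs_mult by (intro mult_left_mono) auto
  with assms show ?thesis by linarith
qed

text \<open>The change from true to eccentric anomaly: a Moebius transformation of \<open>[-1, 1]\<close> in the
  variable \<open>cos x\<close>.\<close>
lemma integral_cos_moebius:
  fixes f :: "real \<Rightarrow> real"
  assumes f: "continuous_on {-1..1} f" and q: "\<bar>q\<bar> < 1"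
  shows "integral {0..pi} (\<lambda>x. f (cos x)) =
    integral {0..pi} (\<lambda>x. sqrt (1 - q\<^sup>2) / (1 + q * cos x) * f ((cos x + q) / (1 + q * cos x)))"
proof -
  define u where "u x = (cos x + q) / (1 + q * cos x)" for x
  note pos = one_plus_mult_cos_pos[OF q]
  have q2: "1 - q\<^sup>2 > 0" using q by (simp add: abs_square_less_1)
  \<comment> \<open>Used twice: it bounds \<open>u\<close> by 1 in absolute value, and it makes the
    root in the derivative of arccos a multiple of sin x, which then cancels.\<close>
  have u2: "1 - (u x)\<^sup>2 = (1 - q\<^sup>2) * (sin x)\<^sup>2 / (1 + q * cos x)\<^sup>2" for x
  proof -
    have "1 - (u x)\<^sup>2 = ((1 + q * cos x)\<^sup>2 - (cos x + q)\<^sup>2) / (1 + q * cos x)\<^sup>2"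
      using pos[of x] by (simp add: u_def power_divide diff_divide_distrib)
    also have "(1 + q * cos x)\<^sup>2 - (cos x + q)\<^sup>2 = (1 - q\<^sup>2) * (sin x)\<^sup>2"
      unfolding sin_squared_eq by (simp add: algebra_simps power2_eq_square)
    finally show ?thesis .
  qed
  have u_bd: "-1 \<le> u x" "u x \<le> 1" for x
  proof -
    have "1 - (u x)\<^sup>2 \<ge> 0" unfolding u2 using q2 by simp
    then have "\<bar>u x\<bar> \<le> 1" by (simp add: abs_square_le_1)
    then show "-1 \<le> u x" "u x \<le> 1" by auto
  qed
  \<comment> \<open>At 0 and pi the value of \<open>u\<close> is 1 or -1, where arccos is not
    differentiable; these two points are the exceptional set of the substitution rule.\<close>
  have deriv: "((\<lambda>x. arccos (u x)) has_field_derivative sqrt (1 - q\<^sup>2) / (1 + q * cos x))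
      (at x within {0..pi})" if x: "x \<in> {0..pi} - {0, pi}" for x
  proof -
    have s: "sin x > 0" using x by (auto intro!: sin_gt_zero)
    have *: "1 - (u x)\<^sup>2 > 0" unfolding u2 using s q2 pos[of x] by simp
    then have "\<bar>u x\<bar> < 1" by (simp add: abs_square_less_1)
    then have u1: "-1 < u x" "u x < 1" by auto
    have du: "(u has_field_derivative - sin x * (1 - q\<^sup>2) / (1 + q * cos x)\<^sup>2) (at x)"
      unfolding u_def using pos[of x]
      by (auto intro!: derivative_eq_intros simp: field_simps power2_eq_square)
    have sq: "sqrt (1 - (u x)\<^sup>2) = sqrt (1 - q\<^sup>2) * sin x / (1 + q * cos x)"
      unfolding u2 using s pos[of x] by (simp add: real_sqrt_mult real_sqrt_divide)
    have "((\<lambda>x. arccos (u x)) has_field_derivative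
        inverse (- sqrt (1 - (u x)\<^sup>2)) * (- sin x * (1 - q\<^sup>2) / (1 + q * cos x)\<^sup>2)) (at x)"
      by (rule DERIV_chain2[OF DERIV_arccos[OF u1] du])
    also have "inverse (- sqrt (1 - (u x)\<^sup>2)) * (- sin x * (1 - q\<^sup>2) / (1 + q * cos x)\<^sup>2) =
        sqrt (1 - q\<^sup>2) / (1 + q * cos x)"
    proof -
      have "inverse (- (A * y / w)) * (- y * (A * A) / w\<^sup>2) = A / w"
        if "A > 0" "y > 0" "w > 0" for A y w :: real
        using that by (simp add: field_simps power2_eq_square)
      from this[of "sqrt (1 - q\<^sup>2)" "sin x" "1 + q * cos x"] show ?thesis
        unfolding sq using s q2 pos[of x] by (simp del: inverse_divide times_divide_eq_left times_divide_eq_right)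
    qed
    finally show ?thesis by (rule has_field_derivative_at_within)
  qed
  have "continuous_on {0..pi} (\<lambda>x. f (cos x))"
    by (rule continuous_on_compose2[OF f]) (auto intro!: continuous_intros)
  moreover have "continuous_on {0..pi} u"
    unfolding u_def using pos by (auto intro!: continuous_intros simp: less_imp_neq[symmetric])
  then have "continuous_on {0..pi} (\<lambda>x. arccos (u x))"
    by (intro continuous_on_arccos) (use u_bd in auto)
  moreover have u_0: "u 0 = 1" "u pi = -1"
    using pos[of 0] pos[of pi] by (auto simp: u_def field_simps)
  ultimately have "((\<lambda>x. (sqrt (1 - q\<^sup>2) / (1 + q * cos x)) *\<^sub>R f (cos (arccos (u x)))) has_integral
      integral {arccos (u 0)..arccos (u pi)} (\<lambda>x. f (cos x))) {0..pi}"
    by (intro has_integral_substitution_strong[where s = "{0, pi}" and c = 0 and d = pi] deriv)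
       (auto simp: arccos_lbound arccos_ubound u_bd)
  then show ?thesis
    unfolding u_0 by (simp add: cos_arccos u_bd u_def[symmetric] integral_unique)
qed

subsection \<open>Complete elliptic integrals\<close>

text \<open>The torsion relation: an explicit primitive exists for this combination of a third kind
  and a first kind integrand. It will eliminate the third kind integral.\<close>

lemma has_integral_third_kind:
  fixes e :: real
  assumes e: "0 < e" "2 * e\<^sup>2 < 1"
  defines "r \<equiv> \<lambda>x. sqrt (1 - 2 * e\<^sup>2 + e ^ 4 * (cos x)\<^sup>2)"
  shows "((\<lambda>x. (2 * (1 - e\<^sup>2) / (1 - e\<^sup>2 * (cos x)\<^sup>2) - 1) / r x) has_integral pi) {0..pi}"
proof -
  define N where "N x = (1 - r x) * sin x * cos x" for x
  define D where "D x = r x * (cos x)\<^sup>2 + (sin x)\<^sup>2" for x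
  have rad: "1 - 2 * e\<^sup>2 + e ^ 4 * (cos x)\<^sup>2 > 0" for x
    using e by (simp add: add_pos_nonneg)
  have r: "r x > 0" and r2: "(r x)\<^sup>2 = 1 - 2 * e\<^sup>2 + e ^ 4 * (cos x)\<^sup>2" for x
    using rad[of x] by (auto simp: r_def)
  have w: "1 - e\<^sup>2 * (cos x)\<^sup>2 > 0" for x
  proof -
    have "e\<^sup>2 * (cos x)\<^sup>2 \<le> e\<^sup>2 * 1" by (intro mult_left_mono) (auto simp: abs_square_le_1)
    then show ?thesis using e by linarith
  qed
  \<comment> \<open>Positivity keeps N / D finite, so the arctan has no jump.\<close>
  have D: "D x > 0" for x
  proof (cases "cos x = 0")
    case True
    then have "(sin x)\<^sup>2 = 1" by (simp add: sin_squared_eq)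
    with True show ?thesis by (simp add: D_def)
  next
    case False
    with r[of x] show ?thesis unfolding D_def by (intro add_pos_nonneg) auto
  qed
  \<comment> \<open>The modulus of D + i N is free of the root \<open>r\<close>. This gives the
    derivative of the arctan the denominator (1 - e^2 cos^2 x)^2.\<close>
  have ND: "(N x)\<^sup>2 + (D x)\<^sup>2 = (1 - e\<^sup>2 * (cos x)\<^sup>2)\<^sup>2" for x
  proof -
    have "(N x)\<^sup>2 + (D x)\<^sup>2 = (sin x)\<^sup>2 * ((sin x)\<^sup>2 + (cos x)\<^sup>2) + (r x)\<^sup>2 * (cos x)\<^sup>2 * ((sin x)\<^sup>2 + (cos x)\<^sup>2)"
      unfolding N_def D_def by algebra
    also have "\<dots> = (1 - e\<^sup>2 * (cos x)\<^sup>2)\<^sup>2"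
      unfolding r2 sin_cos_squared_add by (simp add: sin_squared_eq algebra_simps power2_eq_square power4_eq_xxxx)
    finally show ?thesis .
  qed
  have dr: "(r has_field_derivative - (e ^ 4 * cos x * sin x / r x)) (at x)" for x
    unfolding r_def using rad[of x] by (auto intro!: derivative_eq_intros simp: field_simps)
  \<comment> \<open>On \<open>(0, \<pi>/2)\<close> the primitive is \<open>\<psi>\<close> with \<open>tan \<psi> = tan x / r\<close>; the form \<open>x + arctan (N / D)\<close> is
    smooth across \<open>\<pi>/2\<close>.\<close>
  have dW: "((\<lambda>x. x + arctan (N x / D x)) has_field_derivative
      (2 * (1 - e\<^sup>2) / (1 - e\<^sup>2 * (cos x)\<^sup>2) - 1) / r x) (at x)" for x
  proof -
    define N' where "N' = e ^ 4 * cos x * sin x / r x * sin x * cos x + (1 - r x) * ((cos x)\<^sup>2 - (sin x)\<^sup>2)"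
    define D' where "D' = - (e ^ 4 * cos x * sin x / r x) * (cos x)\<^sup>2 + 2 * (1 - r x) * sin x * cos x"
    have dN: "(N has_field_derivative N') (at x)"
      unfolding N_def[abs_def] N'_def
      by (auto intro!: derivative_eq_intros dr simp: algebra_simps power2_eq_square)
    have dD: "(D has_field_derivative D') (at x)"
      unfolding D_def[abs_def] D'_def
      by (auto intro!: derivative_eq_intros dr simp: algebra_simps power2_eq_square)
    have "((\<lambda>x. x + arctan (N x / D x)) has_field_derivative
        1 + inverse (1 + (N x / D x)\<^sup>2) * ((N' * D x - N x * D') / (D x * D x))) (at x)"
      using D[of x] by (intro derivative_intros DERIV_chain2[OF DERIV_arctan] DERIV_divide dN dD) auto
    also have "1 + inverse (1 + (N x / D x)\<^sup>2) * ((N' * D x - N x * D') / (D x * D x)) =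
        1 + (N' * D x - N x * D') / (1 - e\<^sup>2 * (cos x)\<^sup>2)\<^sup>2"
    proof -
      have "inverse (1 + (N x / D x)\<^sup>2) = (D x)\<^sup>2 / ((N x)\<^sup>2 + (D x)\<^sup>2)"
        using D[of x] by (simp add: field_simps)
      then show ?thesis unfolding ND using D[of x] by (simp add: power2_eq_square)
    qed
    also have "\<dots> = (2 * (1 - e\<^sup>2) / (1 - e\<^sup>2 * (cos x)\<^sup>2) - 1) / r x"
    proof -
      \<comment> \<open>What remains is a polynomial identity modulo R^2 and S^2 = 1 - C^2;
        multiplying N' and D' by R clears the denominator coming from the derivative of
        \<open>r\<close>.\<close>
      define R C S E where "R = r x" "C = cos x" "S = sin x" "E = e\<^sup>2"
      have R: "R > 0" "R\<^sup>2 = 1 - 2 * E + E\<^sup>2 * C\<^sup>2"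
        using r[of x] r2[of x] by (auto simp: R_C_S_E_def)
      have W: "1 - E * C\<^sup>2 > 0" using w[of x] by (simp add: R_C_S_E_def)
      have cs: "S\<^sup>2 = 1 - C\<^sup>2" by (simp add: R_C_S_E_def sin_squared_eq)
      have e4: "e ^ 4 = E\<^sup>2" by (simp add: R_C_S_E_def)
      have A: "R * (N' * D x - N x * D') = (1 - E * C\<^sup>2) * (1 - 2 * E + E * C\<^sup>2) - R * (1 - E * C\<^sup>2)\<^sup>2"
      proof -
        have n: "R * N' = E\<^sup>2 * C\<^sup>2 * S\<^sup>2 + R * (1 - R) * (C\<^sup>2 - S\<^sup>2)"
          unfolding N'_def e4 R_C_S_E_def(1-3)[symmetric] using R(1)
          by (simp add: field_simps power2_eq_square)
        have d: "R * D' = - (E\<^sup>2 * S * C * C\<^sup>2) + 2 * R * (1 - R) * S * C"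
          unfolding D'_def e4 R_C_S_E_def(1-3)[symmetric] using R(1)
          by (simp add: field_simps power2_eq_square)
        have "R * (N' * D x - N x * D') = (R * N') * D x - N x * (R * D')"
          by (simp add: algebra_simps)
        also have "\<dots> = (1 - E * C\<^sup>2) * (1 - 2 * E + E * C\<^sup>2) - R * (1 - E * C\<^sup>2)\<^sup>2"
          unfolding n d N_def D_def R_C_S_E_def(1-3)[symmetric] using R(2) cs by algebra
        finally show ?thesis .
      qed
      have "1 + (N' * D x - N x * D') / (1 - E * C\<^sup>2)\<^sup>2 =
          ((1 - E * C\<^sup>2)\<^sup>2 * R + R * (N' * D x - N x * D')) / ((1 - E * C\<^sup>2)\<^sup>2 * R)"
        using R(1) W by (simp add: field_simps)
      also have "\<dots> = (1 - 2 * E + E * C\<^sup>2) / ((1 - E * C\<^sup>2) * R)"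
      proof -
        have "(w\<^sup>2 * R + (w * y - R * w\<^sup>2)) / (w\<^sup>2 * R) = y / (w * R)" if "w > 0" for w y
          using R(1) that by (simp add: field_simps power2_eq_square)
        from this[OF W] show ?thesis unfolding A .
      qed
      also have "\<dots> = (2 * (1 - E) / (1 - E * C\<^sup>2) - 1) / R"
        using R(1) W by (simp add: field_simps)
      finally show ?thesis unfolding R_C_S_E_def .
    qed
    finally show ?thesis .
  qed
  \<comment> \<open>N vanishes at both ends because sin does, so only the summand x
    contributes.\<close>
  have "((\<lambda>x. (2 * (1 - e\<^sup>2) / (1 - e\<^sup>2 * (cos x)\<^sup>2) - 1) / r x) has_integral
      (pi + arctan (N pi / D pi)) - (0 + arctan (N 0 / D 0))) {0..pi}"
    using has_field_derivative_at_within[OF dW]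
    by (intro fundamental_theorem_of_calculus) (simp_all add: has_real_derivative_iff_has_vector_derivative)
  then show ?thesis by (simp add: N_def)
qed

text \<open>In t = cos x the branch points are -1, 1, -m - 1 and -m + 1. A Moebius map sends -m - 1
  to infinity, which leaves a radicand linear in cos x; doubling the angle makes it even in cos
  x.\<close>

lemma integral_inverse_sqrt_landen:
  fixes m :: real
  assumes m: "m > 2"
  shows "integral {0..pi} (\<lambda>x. 1 / sqrt ((m + cos x)\<^sup>2 - 1)) =
         integral {0..pi} (\<lambda>x. 1 / sqrt (m\<^sup>2 - 4 + 4 * (cos x)\<^sup>2))"
proof -
  \<comment> \<open>Chosen so that 1 / q = -(m + 1): the image of infinity under (t + q) / (1 + q t)
    is then a zero of the radicand.\<close>
  define q where "q = - 1 / (m + 1)"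
  have q: "\<bar>q\<bar> < 1" using m by (simp add: q_def)
  have m2: "m\<^sup>2 > 4" using power_strict_mono[of 2 m 2] m by simp
  have nz1: "sqrt ((m + t)\<^sup>2 - 1) \<noteq> 0" if "t \<in> {-1..1}" for t
  proof -
    have "1 < m + t" using m that by auto
    then have "1\<^sup>2 < (m + t)\<^sup>2" by (intro power_strict_mono) auto
    then show ?thesis by simp
  qed
  have nz2: "sqrt (m\<^sup>2 - 2 + 2 * t) \<noteq> 0" if "t \<in> {-1..1}" for t
    using m2 that by simp
  have q2: "1 - q\<^sup>2 = m * (m + 2) / (m + 1)\<^sup>2"
  proof -
    have "1 - q\<^sup>2 = ((m + 1)\<^sup>2 - 1) / (m + 1)\<^sup>2"
      using m by (simp add: q_def power_divide diff_divide_distrib)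
    then show ?thesis by (simp add: algebra_simps power2_eq_square)
  qed
  have "integral {0..pi} (\<lambda>x. 1 / sqrt ((m + cos x)\<^sup>2 - 1)) =
    integral {0..pi} (\<lambda>x. sqrt (1 - q\<^sup>2) / (1 + q * cos x) *
      (1 / sqrt ((m + (cos x + q) / (1 + q * cos x))\<^sup>2 - 1)))"
    by (intro integral_cos_moebius[OF _ q] continuous_intros ballI nz1)
  also have "\<dots> = integral {0..pi} (\<lambda>x. 1 / sqrt (m\<^sup>2 - 2 + 2 * cos x))"
  proof (rule integral_cong)
    fix x :: real
    have pos: "1 + q * cos x > 0" by (rule one_plus_mult_cos_pos[OF q])
    let ?u = "(cos x + q) / (1 + q * cos x)"
    have "m + ?u = ((m + cos x) + q * (1 + m * cos x)) / (1 + q * cos x)"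
      using pos by (simp add: field_simps)
    then have "(m + ?u)\<^sup>2 - 1 = (((m + cos x) + q * (1 + m * cos x))\<^sup>2 - (1 + q * cos x)\<^sup>2) / (1 + q * cos x)\<^sup>2"
      using pos by (simp add: power_divide diff_divide_distrib)
    also have "((m + cos x) + q * (1 + m * cos x))\<^sup>2 - (1 + q * cos x)\<^sup>2 =
        (1 - q\<^sup>2) * (m\<^sup>2 - 2 + 2 * cos x)"
    proof -
      have "q * (m + 1) = - 1" using m by (simp add: q_def)
      then show ?thesis by algebra
    qed
    finally have "sqrt ((m + ?u)\<^sup>2 - 1) = sqrt (1 - q\<^sup>2) * sqrt (m\<^sup>2 - 2 + 2 * cos x) / (1 + q * cos x)"
      using pos by (simp add: real_sqrt_mult real_sqrt_divide)
    moreover have "sqrt (1 - q\<^sup>2) > 0"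
      using q by (simp add: abs_square_less_1)
    ultimately show "sqrt (1 - q\<^sup>2) / (1 + q * cos x) * (1 / sqrt ((m + ?u)\<^sup>2 - 1)) =
        1 / sqrt (m\<^sup>2 - 2 + 2 * cos x)"
      using pos by simp
  qed
  also have "\<dots> = integral {0..pi} (\<lambda>x. 1 / sqrt (m\<^sup>2 - 2 + 2 * cos (2 * x)))"
    by (intro integral_cos_double[symmetric] continuous_intros ballI nz2)
  also have "\<dots> = integral {0..pi} (\<lambda>x. 1 / sqrt (m\<^sup>2 - 4 + 4 * (cos x)\<^sup>2))"
    unfolding cos_double_cos by (simp add: algebra_simps)
  finally show ?thesis .
qed

text \<open>The left side arises from differentiating \<open>arsinh_integral\<close>. The Moebius
  map with parameter e makes the radicand even in cos x, and symmetrising then merges the pole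
  factor 1 + e cos x with its mirror image.\<close>

lemma integral_linear_over_sqrt:
  fixes e :: real
  assumes e: "0 < e" "2 * e\<^sup>2 < 1"
  defines "r \<equiv> \<lambda>x. sqrt (1 - 2 * e\<^sup>2 + e ^ 4 * (cos x)\<^sup>2)"
  shows "integral {0..pi} (\<lambda>x. (1 / e\<^sup>2 - 3 + 2 * e * cos x) / sqrt ((1 / e - e - cos x)\<^sup>2 + 1 - 2 * e\<^sup>2)) =
    (1 - e\<^sup>2) / e * integral {0..pi} (\<lambda>x. (1 - 2 * e\<^sup>2 / (1 - e\<^sup>2 * (cos x)\<^sup>2)) / r x)"
proof -
  \<comment> \<open>Up to the factor (1 - e^2) / e this is the integrand after the substitution, as
    a function of t = cos x.\<close>
  define h where "h t = ((1 - 2 * e\<^sup>2) + e * t) / ((1 + e * t) * sqrt (1 - 2 * e\<^sup>2 + e ^ 4 * t\<^sup>2))" for t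
  have e2: "e\<^sup>2 < 1" using e zero_le_power2[of e] by linarith
  then have e1: "e < 1" "\<bar>e\<bar> < 1" using e by (simp_all add: abs_square_less_1)
  have rad: "1 - 2 * e\<^sup>2 + e ^ 4 * t\<^sup>2 > 0" for t
    using e by (simp add: add_pos_nonneg)
  have et: "1 + e * t > 0" if "t \<in> {-1..1}" for t
  proof -
    have "e * (- t) \<le> e * 1" using e that by (intro mult_left_mono) auto
    then show ?thesis using e1 by simp
  qed
  have S: "sqrt ((1 / e - e - t)\<^sup>2 + 1 - 2 * e\<^sup>2) \<noteq> 0" for t
  proof -
    have "(1 / e - e - t)\<^sup>2 + 1 - 2 * e\<^sup>2 > 0"
      using e zero_le_power2[of "1 / e - e - t"] by linarith
    then have "sqrt ((1 / e - e - t)\<^sup>2 + 1 - 2 * e\<^sup>2) > 0" by (simp only: real_sqrt_gt_0_iff)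
    then show ?thesis by (rule less_imp_neq[symmetric])
  qed
  have "(1 + e * t) * sqrt (1 - 2 * e\<^sup>2 + e ^ 4 * t\<^sup>2) \<noteq> 0" if "t \<in> {-1..1}" for t
    using rad[of t] et[OF that] by simp
  then have h: "continuous_on {-1..1} h"
    unfolding h_def by (intro continuous_intros ballI)
  have hcos: "(\<lambda>x. h (cos x)) integrable_on {0..pi}" "(\<lambda>x. h (- cos x)) integrable_on {0..pi}"
    by (intro integrable_continuous_real continuous_on_compose2[OF h];
        auto intro!: continuous_intros simp: minus_le_iff)+
  have "integral {0..pi} (\<lambda>x. (1 / e\<^sup>2 - 3 + 2 * e * cos x) / sqrt ((1 / e - e - cos x)\<^sup>2 + 1 - 2 * e\<^sup>2)) =
    integral {0..pi} (\<lambda>x. sqrt (1 - e\<^sup>2) / (1 + e * cos x) *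
      ((1 / e\<^sup>2 - 3 + 2 * e * ((cos x + e) / (1 + e * cos x))) /
        sqrt ((1 / e - e - (cos x + e) / (1 + e * cos x))\<^sup>2 + 1 - 2 * e\<^sup>2)))"
    by (intro integral_cos_moebius[OF _ e1(2)] continuous_intros ballI S)
  also have "\<dots> = integral {0..pi} (\<lambda>x. (1 - e\<^sup>2) / e * h (cos x))"
  proof (rule integral_cong)
    fix x :: real
    define C W where "C = cos x" "W = 1 + e * C"
    have W: "W > 0" unfolding C_W_def by (rule one_plus_mult_cos_pos[OF e1(2)])
    define R where "R = sqrt (1 - 2 * e\<^sup>2 + e ^ 4 * C\<^sup>2)"
    have R: "R > 0" using rad by (simp add: R_def)
    define A where "A = sqrt (1 - e\<^sup>2)"
    have A: "A > 0" using e2 by (simp add: A_def)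
    have num: "1 / e\<^sup>2 - 3 + 2 * e * ((C + e) / W) = (1 - e\<^sup>2) / e\<^sup>2 * ((1 - 2 * e\<^sup>2) + e * C) / W"
    proof -
      have "(1 / e\<^sup>2 - 3 + 2 * e * ((C + e) / W)) * (e\<^sup>2 * W) = (1 - 3 * e\<^sup>2) * W + 2 * e ^ 3 * (C + e)"
        using W e by (simp add: field_simps power2_eq_square power3_eq_cube)
      also have "\<dots> = (1 - e\<^sup>2) * ((1 - 2 * e\<^sup>2) + e * C)"
        unfolding C_W_def by algebra
      finally have "1 / e\<^sup>2 - 3 + 2 * e * ((C + e) / W) =
          ((1 - e\<^sup>2) * ((1 - 2 * e\<^sup>2) + e * C)) / (e\<^sup>2 * W)"
        using W e by (subst nonzero_eq_divide_eq) auto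
      then show ?thesis by simp
    qed
    have "1 / e - e - (C + e) / W = ((1 - e\<^sup>2) * W - e * (C + e)) / (e * W)"
      using W e by (simp add: field_simps power2_eq_square)
    then have "(1 / e - e - (C + e) / W)\<^sup>2 + 1 - 2 * e\<^sup>2 =
        (((1 - e\<^sup>2) * W - e * (C + e))\<^sup>2 + (1 - 2 * e\<^sup>2) * (e * W)\<^sup>2) / (e * W)\<^sup>2"
      using W e by (simp add: power_divide add_divide_distrib)
    \<comment> \<open>The terms linear in C cancel here; this is what the choice of e as Moebius
      parameter achieves.\<close>
    also have "((1 - e\<^sup>2) * W - e * (C + e))\<^sup>2 + (1 - 2 * e\<^sup>2) * (e * W)\<^sup>2 =
        (1 - e\<^sup>2) * (1 - 2 * e\<^sup>2 + e ^ 4 * C\<^sup>2)"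
      unfolding C_W_def by algebra
    finally have S: "sqrt ((1 / e - e - (C + e) / W)\<^sup>2 + 1 - 2 * e\<^sup>2) = A * R / (e * W)"
      using W e by (simp add: real_sqrt_mult real_sqrt_divide A_def R_def)
    show "sqrt (1 - e\<^sup>2) / (1 + e * cos x) *
      ((1 / e\<^sup>2 - 3 + 2 * e * ((cos x + e) / (1 + e * cos x))) /
        sqrt ((1 / e - e - (cos x + e) / (1 + e * cos x))\<^sup>2 + 1 - 2 * e\<^sup>2)) = (1 - e\<^sup>2) / e * h (cos x)"
      unfolding h_def C_W_def[symmetric] R_def[symmetric] A_def[symmetric] num S
      using W R A e by (simp add: power2_eq_square)
  qed
  also have "\<dots> = (1 - e\<^sup>2) / e * integral {0..pi} (\<lambda>x. h (cos x))"
    by simp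
  \<comment> \<open>Averaging over x and pi - x discards the part that is odd in cos x.\<close>
  also have "integral {0..pi} (\<lambda>x. h (cos x)) =
      integral {0..pi} (\<lambda>x. (h (cos x) + h (- cos x)) / 2)"
    using integral_cos_reflect[OF h] by (simp add: integral_add[OF hcos])
  also have "\<dots> = integral {0..pi} (\<lambda>x. (1 - 2 * e\<^sup>2 / (1 - e\<^sup>2 * (cos x)\<^sup>2)) / r x)"
  proof (rule integral_cong)
    fix x :: real
    define C where "C = cos x"
    have W: "1 + e * C > 0" "1 - e * C > 0"
      using et[of C] et[of "- C"] by (auto simp: C_def minus_le_iff)
    have R: "r x > 0" using rad by (simp add: r_def)
    have f: "1 - e\<^sup>2 * C\<^sup>2 = (1 + e * C) * (1 - e * C)" by algebra
    have "(h (cos x) + h (- cos x)) / 2 =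
        (((1 - 2 * e\<^sup>2) + e * C) / ((1 + e * C) * r x) + ((1 - 2 * e\<^sup>2) - e * C) / ((1 - e * C) * r x)) / 2"
      by (simp add: h_def r_def C_def)
    also have "((((1 - 2 * e\<^sup>2) + e * C) / ((1 + e * C) * r x)) + ((1 - 2 * e\<^sup>2) - e * C) / ((1 - e * C) * r x)) / 2 =
        ((((1 - 2 * e\<^sup>2) + e * C) * (1 - e * C) + ((1 - 2 * e\<^sup>2) - e * C) * (1 + e * C)) / 2)
          / ((1 + e * C) * (1 - e * C) * r x)"
    proof -
      have "(X / (A * R) + Y / (B * R)) / 2 = ((X * B + Y * A) / 2) / (A * B * R)"
        if "A > 0" "B > 0" "R > 0" for A B R X Y :: real
        using that by (simp add: field_simps)
      from this[OF W R] show ?thesis .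
    qed
    also have "(((1 - 2 * e\<^sup>2) + e * C) * (1 - e * C) + ((1 - 2 * e\<^sup>2) - e * C) * (1 + e * C)) / 2 =
        (1 + e * C) * (1 - e * C) - 2 * e\<^sup>2"
      by algebra
    also have "\<dots> / ((1 + e * C) * (1 - e * C) * r x) = (1 - 2 * e\<^sup>2 / ((1 + e * C) * (1 - e * C))) / r x"
      using W by (simp add: diff_divide_distrib)
    finally show "(h (cos x) + h (- cos x)) / 2 = (1 - 2 * e\<^sup>2 / (1 - e\<^sup>2 * (cos x)\<^sup>2)) / r x"
      unfolding f[unfolded C_def] by (simp only: C_def)
  qed
  finally show ?thesis .
qed

subsection \<open>Dependence on the parameter\<close>

text \<open>Equals pi times m(P_{1,k}) for e = 2 / sqrt (k + 4), where k / 2 = 2 / e^2 - 2.\<close>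

definition arcosh_integral :: "real \<Rightarrow> real" where
  "arcosh_integral e = integral {0..pi} (\<lambda>x. arcosh (2 / e\<^sup>2 - 2 + cos x))"

text \<open>Equals pi times the difference of the half Mahler measures for the same e.\<close>

definition arsinh_integral :: "real \<Rightarrow> real" where
  "arsinh_integral e = integral {0..pi} (\<lambda>x. arsinh ((1 / e - e - cos x) / sqrt (1 - 2 * e\<^sup>2)))"

lemma two_power2_less_1_iff: "2 * e\<^sup>2 < 1 \<longleftrightarrow> e < sqrt (1 / 2)" if "0 < e" for e :: real
proof -
  have "sqrt (e\<^sup>2) < sqrt (1 / 2) \<longleftrightarrow> e\<^sup>2 < 1 / 2"
    by (rule real_sqrt_less_iff)
  with that show ?thesis by (simp add: mult.commute)
qed

lemma arcosh_arg_gt_1: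
  fixes e :: real
  assumes "0 < e" "2 * e\<^sup>2 < 1"
  shows "2 / e\<^sup>2 - 2 > 2" "2 / e\<^sup>2 - 2 + cos x > 1"
proof -
  show *: "2 / e\<^sup>2 - 2 > 2" using assms by (simp add: field_simps)
  show "2 / e\<^sup>2 - 2 + cos x > 1" using * cos_ge_minus_one[of x] by linarith
qed

text \<open>Differentiation under the integral gives a first kind integral; the Landen step with m =
  2 / e^2 - 2 brings it to the common radicand.\<close>

lemma arcosh_integral_has_derivative:
  assumes e: "0 < e" "2 * e\<^sup>2 < 1"
  shows "(arcosh_integral has_real_derivative
    - 2 / e * integral {0..pi} (\<lambda>x. 1 / sqrt (1 - 2 * e\<^sup>2 + e ^ 4 * (cos x)\<^sup>2))) (at e)"
proof -
  \<comment> \<open>The range of e that corresponds to k > 4. It is convex, as the Leibniz rule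
    requires, and open, so the derivative within it is a full one.\<close>
  let ?U = "{0<..<sqrt (1 / 2)}"
  let ?d = "\<lambda>e x. - 4 / e ^ 3 * (1 / sqrt ((2 / e\<^sup>2 - 2 + cos x)\<^sup>2 - 1))"
  have U: "0 < e" "2 * e\<^sup>2 < 1" if "e \<in> ?U" for e
    using that two_power2_less_1_iff[of e] by auto
  have eU: "e \<in> ?U" using e two_power2_less_1_iff[of e] by auto
  have nz: "sqrt ((2 / e\<^sup>2 - 2 + cos x)\<^sup>2 - 1) \<noteq> 0" if "e \<in> ?U" for e x
  proof -
    have "1\<^sup>2 < (2 / e\<^sup>2 - 2 + cos x)\<^sup>2"
      using arcosh_arg_gt_1[OF U[OF that]] by (intro power_strict_mono) auto
    then show ?thesis by simp
  qed
  have "((\<lambda>e. integral (cbox 0 pi) (\<lambda>x. arcosh (2 / e\<^sup>2 - 2 + cos x))) has_real_derivative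
      integral (cbox 0 pi) (?d e)) (at e within ?U)"
  proof (rule leibniz_rule_field_derivative[OF _ _ _ eU])
    fix y x :: real assume y: "y \<in> ?U"
    have "((\<lambda>e. 2 / e\<^sup>2 - 2 + cos x) has_real_derivative - 4 / y ^ 3) (at y within ?U)"
      using U[OF y] by (auto intro!: derivative_eq_intros simp: power2_eq_square power3_eq_cube)
    from DERIV_chain2[OF arcosh_real_has_field_derivative[OF arcosh_arg_gt_1(2)[OF U[OF y]]] this]
    show "((\<lambda>e. arcosh (2 / e\<^sup>2 - 2 + cos x)) has_real_derivative ?d y x) (at y within ?U)"
      by (simp only: mult.commute)
  next
    fix y assume "y \<in> ?U"
    then show "(\<lambda>x. arcosh (2 / y\<^sup>2 - 2 + cos x)) integrable_on cbox 0 pi"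
      unfolding cbox_interval using arcosh_arg_gt_1(2)[OF U[of y]]
      by (intro integrable_continuous_real continuous_intros) (auto simp: less_imp_le)
  next
    have "y \<noteq> 0" if "y \<in> ?U" for y using that by auto
    with nz show "continuous_on (?U \<times> cbox 0 pi) (\<lambda>(e, x). ?d e x)"
      unfolding case_prod_beta by (intro continuous_intros) auto
  qed auto
  then have "(arcosh_integral has_real_derivative integral {0..pi} (?d e)) (at e)"
    unfolding arcosh_integral_def[abs_def] cbox_interval by (subst (asm) at_within_open[OF eU]) auto
  also have "integral {0..pi} (?d e) =
      - 4 / e ^ 3 * integral {0..pi} (\<lambda>x. 1 / sqrt ((2 / e\<^sup>2 - 2 + cos x)\<^sup>2 - 1))"
    by (rule integral_mult_right)
  also have "\<dots> = - 4 / e ^ 3 * integral {0..pi} (\<lambda>x. 1 / sqrt ((2 / e\<^sup>2 - 2)\<^sup>2 - 4 + 4 * (cos x)\<^sup>2))"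
    by (subst integral_inverse_sqrt_landen[OF arcosh_arg_gt_1(1)[OF e]]) (rule refl)
  also have "(\<lambda>x. 1 / sqrt ((2 / e\<^sup>2 - 2)\<^sup>2 - 4 + 4 * (cos x)\<^sup>2)) =
      (\<lambda>x. e\<^sup>2 / 2 * (1 / sqrt (1 - 2 * e\<^sup>2 + e ^ 4 * (cos x)\<^sup>2)))"
  proof
    fix x
    have "(2 / e\<^sup>2 - 2)\<^sup>2 - 4 + 4 * (cos x)\<^sup>2 = (2 / e\<^sup>2)\<^sup>2 * (1 - 2 * e\<^sup>2 + e ^ 4 * (cos x)\<^sup>2)"
      using e by (simp add: field_simps power2_eq_square power4_eq_xxxx)
    then show "1 / sqrt ((2 / e\<^sup>2 - 2)\<^sup>2 - 4 + 4 * (cos x)\<^sup>2) =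
        e\<^sup>2 / 2 * (1 / sqrt (1 - 2 * e\<^sup>2 + e ^ 4 * (cos x)\<^sup>2))"
      using e by (simp add: real_sqrt_mult)
  qed
  also have "- 4 / e ^ 3 * integral {0..pi} (\<lambda>x. e\<^sup>2 / 2 * (1 / sqrt (1 - 2 * e\<^sup>2 + e ^ 4 * (cos x)\<^sup>2))) =
      - 2 / e * integral {0..pi} (\<lambda>x. 1 / sqrt (1 - 2 * e\<^sup>2 + e ^ 4 * (cos x)\<^sup>2))"
    unfolding integral_mult_right using e by (simp add: power2_eq_square power3_eq_cube)
  finally show ?thesis .
qed

text \<open>Differentiating N / w with w^2 = 1 - 2 e^2 leaves a numerator linear in cos x over sqrt
  (N^2 + w^2), which is the integral reduced before.\<close>

lemma arsinh_integral_has_derivative: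
  assumes e: "0 < e" "2 * e\<^sup>2 < 1"
  shows "(arsinh_integral has_real_derivative
    - ((1 - e\<^sup>2) / (e * (1 - 2 * e\<^sup>2))) *
      integral {0..pi} (\<lambda>x. (1 - 2 * e\<^sup>2 / (1 - e\<^sup>2 * (cos x)\<^sup>2)) / sqrt (1 - 2 * e\<^sup>2 + e ^ 4 * (cos x)\<^sup>2))) (at e)"
proof -
  let ?U = "{0<..<sqrt (1 / 2)}"
  let ?d = "\<lambda>e x. - 1 / (1 - 2 * e\<^sup>2) *
    ((1 / e\<^sup>2 - 3 + 2 * e * cos x) / sqrt ((1 / e - e - cos x)\<^sup>2 + 1 - 2 * e\<^sup>2))"
  have U: "0 < e" "2 * e\<^sup>2 < 1" if "e \<in> ?U" for e
    using that two_power2_less_1_iff[of e] by auto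
  have eU: "e \<in> ?U" using e two_power2_less_1_iff[of e] by auto
  have pos: "(1 / e - e - cos x)\<^sup>2 + 1 - 2 * e\<^sup>2 > 0" if "e \<in> ?U" for e x
    using U[OF that] zero_le_power2[of "1 / e - e - cos x"] by linarith
  have "((\<lambda>e. integral (cbox 0 pi) (\<lambda>x. arsinh ((1 / e - e - cos x) / sqrt (1 - 2 * e\<^sup>2))))
      has_real_derivative integral (cbox 0 pi) (?d e)) (at e within ?U)"
  proof (rule leibniz_rule_field_derivative[OF _ _ _ eU])
    fix y x :: real assume y: "y \<in> ?U"
    define w where "w = sqrt (1 - 2 * y\<^sup>2)"
    define N where "N = 1 / y - y - cos x"
    have w: "w > 0" "w\<^sup>2 = 1 - 2 * y\<^sup>2" using U[OF y] by (auto simp: w_def)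
    have S: "sqrt (N\<^sup>2 + w\<^sup>2) > 0" using pos[OF y, of x] by (simp add: w N_def)
    have "((\<lambda>e. 1 - 2 * e\<^sup>2) has_real_derivative - 4 * y) (at y within ?U)"
      by (auto intro!: derivative_eq_intros)
    from DERIV_chain2[OF DERIV_real_sqrt this] U[OF y]
    have dw: "((\<lambda>e. sqrt (1 - 2 * e\<^sup>2)) has_real_derivative - 2 * y / w) (at y within ?U)"
      by (simp add: w_def field_simps)
    have dN: "((\<lambda>e. 1 / e - e - cos x) has_real_derivative - 1 / y\<^sup>2 - 1) (at y within ?U)"
      using U[OF y] by (auto intro!: derivative_eq_intros simp: power2_eq_square)
    have "((\<lambda>e. arsinh ((1 / e - e - cos x) / sqrt (1 - 2 * e\<^sup>2))) has_real_derivative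
        1 / sqrt ((N / w)\<^sup>2 + 1) * (((- 1 / y\<^sup>2 - 1) * w - N * (- 2 * y / w)) / (w * w))) (at y within ?U)"
      unfolding N_def w_def
      by (intro DERIV_chain2[OF arsinh_real_has_field_derivative] DERIV_divide dN dw[unfolded w_def])
         (use U[OF y] in auto)
    also have "1 / sqrt ((N / w)\<^sup>2 + 1) * (((- 1 / y\<^sup>2 - 1) * w - N * (- 2 * y / w)) / (w * w)) =
        - 1 / w\<^sup>2 * (((1 / y\<^sup>2 + 1) * w\<^sup>2 - 2 * y * N) / sqrt (N\<^sup>2 + w\<^sup>2))"
    proof -
      have "(N / w)\<^sup>2 + 1 = (N\<^sup>2 + w\<^sup>2) / w\<^sup>2"
        using w(1) by (simp add: power_divide add_divide_distrib)
      then have A: "sqrt ((N / w)\<^sup>2 + 1) = sqrt (N\<^sup>2 + w\<^sup>2) / w"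
        using w(1) by (simp add: real_sqrt_divide)
      have B: "(- 1 / y\<^sup>2 - 1) * w - N * (- 2 * y / w) = - ((1 / y\<^sup>2 + 1) * w\<^sup>2 - 2 * y * N) / w"
        using w(1) U[OF y] by (simp add: field_simps power2_eq_square)
      have "1 / (T / w) * (- X / w / (w * w)) = - 1 / w\<^sup>2 * (X / T)" if "T > 0" for T X
        using w(1) that by (simp add: field_simps power2_eq_square)
      from this[OF S] show ?thesis unfolding A B .
    qed
    also have "(1 / y\<^sup>2 + 1) * w\<^sup>2 - 2 * y * N = 1 / y\<^sup>2 - 3 + 2 * y * cos x"
      unfolding w N_def using U[OF y] by (simp add: field_simps power2_eq_square)
    finally show "((\<lambda>e. arsinh ((1 / e - e - cos x) / sqrt (1 - 2 * e\<^sup>2))) has_real_derivative ?d y x)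
        (at y within ?U)"
      unfolding w N_def by (simp add: add_diff_eq)
  next
    fix y assume "y \<in> ?U"
    then show "(\<lambda>x. arsinh ((1 / y - y - cos x) / sqrt (1 - 2 * y\<^sup>2))) integrable_on cbox 0 pi"
      unfolding cbox_interval using U[of y]
      by (intro integrable_continuous_real continuous_intros) auto
  next
    have "y \<noteq> 0" "1 - 2 * y\<^sup>2 \<noteq> 0" if "y \<in> ?U" for y using U[OF that] by auto
    moreover have "sqrt ((1 / y - y - cos x)\<^sup>2 + 1 - 2 * y\<^sup>2) \<noteq> 0" if "y \<in> ?U" for x y
      using pos[OF that, of x] by (metis less_irrefl real_sqrt_eq_zero_cancel_iff)
    ultimately show "continuous_on (?U \<times> cbox 0 pi) (\<lambda>(e, x). ?d e x)"
      unfolding case_prod_beta by (intro continuous_intros) auto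
  qed auto
  then have "(arsinh_integral has_real_derivative integral {0..pi} (?d e)) (at e)"
    unfolding arsinh_integral_def[abs_def] cbox_interval by (subst (asm) at_within_open[OF eU]) auto
  also have "integral {0..pi} (?d e) = - 1 / (1 - 2 * e\<^sup>2) *
      integral {0..pi} (\<lambda>x. (1 / e\<^sup>2 - 3 + 2 * e * cos x) / sqrt ((1 / e - e - cos x)\<^sup>2 + 1 - 2 * e\<^sup>2))"
    by (rule integral_mult_right)
  finally show ?thesis
    unfolding integral_linear_over_sqrt[OF e] by (simp add: mult.commute)
qed

section \<open>Difference of the two sides, multiplied by pi\<close>

definition integral_gap :: "real \<Rightarrow> real" where
  "integral_gap e = arcosh_integral e - 2 * arsinh_integral e - pi / 2 * ln (1 - 2 * e\<^sup>2)"

text \<open>The torsion relation expresses the third kind integral by the first kind one. The first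
  kind terms then cancel, and the constant pi left over is matched by the derivative of the
  logarithm.\<close>

lemma integral_gap_has_derivative_0:
  assumes e: "0 < e" "2 * e\<^sup>2 < 1"
  shows "(integral_gap has_real_derivative 0) (at e)"
proof -
  define r where "r x = sqrt (1 - 2 * e\<^sup>2 + e ^ 4 * (cos x)\<^sup>2)" for x
  have r: "r x > 0" for x using e by (simp add: r_def add_pos_nonneg)
  have w: "1 - e\<^sup>2 * (cos x)\<^sup>2 > 0" for x
  proof -
    have "e\<^sup>2 * (cos x)\<^sup>2 \<le> e\<^sup>2 * 1" by (intro mult_left_mono) (auto simp: abs_square_le_1)
    then show ?thesis using e by linarith
  qed
  define I0 I1 where "I0 = integral {0..pi} (\<lambda>x. 1 / r x)"
    "I1 = integral {0..pi} (\<lambda>x. 1 / ((1 - e\<^sup>2 * (cos x)\<^sup>2) * r x))"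
  have rc: "continuous_on {0..pi} r" unfolding r_def by (intro continuous_intros)
  have int0: "((\<lambda>x. 1 / r x) has_integral I0) {0..pi}"
    unfolding I0_I1_def using r
    by (intro integrable_integral integrable_continuous_real continuous_intros rc) (auto simp: less_imp_neq[symmetric])
  have int1: "((\<lambda>x. 1 / ((1 - e\<^sup>2 * (cos x)\<^sup>2) * r x)) has_integral I1) {0..pi}"
    unfolding I0_I1_def using r w
    by (intro integrable_integral integrable_continuous_real continuous_intros rc) (auto simp: less_imp_neq[symmetric])
  \<comment> \<open>Needed for two pairs (a, b): one for the torsion relation, one for the
    derivative of \<open>arsinh_integral\<close>.\<close>
  have lin: "((\<lambda>x. (a / (1 - e\<^sup>2 * (cos x)\<^sup>2) + b) / r x) has_integral a * I1 + b * I0) {0..pi}" for a b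
    using has_integral_add[OF has_integral_mult_right[OF int1, of a] has_integral_mult_right[OF int0, of b]]
    by (simp add: add_divide_distrib)
  have "((\<lambda>x. (2 * (1 - e\<^sup>2) / (1 - e\<^sup>2 * (cos x)\<^sup>2) + (- 1)) / r x) has_integral pi) {0..pi}"
    using has_integral_third_kind[OF e] by (simp add: r_def)
  from has_integral_unique[OF lin this] have "2 * (1 - e\<^sup>2) * I1 + (- 1) * I0 = pi" .
  then have rel: "2 * (1 - e\<^sup>2) * I1 = pi + I0" by simp
  have J: "integral {0..pi} (\<lambda>x. (1 - 2 * e\<^sup>2 / (1 - e\<^sup>2 * (cos x)\<^sup>2)) / r x) = I0 - 2 * e\<^sup>2 * I1"
    using integral_unique[OF lin[of "- 2 * e\<^sup>2" 1]] by (simp add: algebra_simps)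
  have dl: "((\<lambda>e. ln (1 - 2 * e\<^sup>2)) has_real_derivative - 4 * e / (1 - 2 * e\<^sup>2)) (at e)"
    using e by (auto intro!: derivative_eq_intros)
  have "(integral_gap has_real_derivative
      - 2 / e * I0 - 2 * (- ((1 - e\<^sup>2) / (e * (1 - 2 * e\<^sup>2))) * (I0 - 2 * e\<^sup>2 * I1)) -
        pi / 2 * (- 4 * e / (1 - 2 * e\<^sup>2))) (at e)"
    unfolding integral_gap_def[abs_def]
    by (intro DERIV_diff DERIV_cmult dl
        arcosh_integral_has_derivative[OF e, folded r_def, folded I0_I1_def(1)]
        arsinh_integral_has_derivative[OF e, folded r_def, unfolded J])
  also have "- 2 / e * I0 - 2 * (- ((1 - e\<^sup>2) / (e * (1 - 2 * e\<^sup>2))) * (I0 - 2 * e\<^sup>2 * I1)) -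
        pi / 2 * (- 4 * e / (1 - 2 * e\<^sup>2)) =
      2 / (e * (1 - 2 * e\<^sup>2)) * (- (1 - 2 * e\<^sup>2) * I0 + (1 - e\<^sup>2) * (I0 - 2 * e\<^sup>2 * I1) + pi * e\<^sup>2)"
  proof -
    have "- 2 / e * I0 - 2 * (- (a / (e * b)) * J) - pi / 2 * (- 4 * e / b) =
        2 / (e * b) * (- b * I0 + a * J + pi * e\<^sup>2)" if "b \<noteq> 0" for a b J
      using e that by (simp add: field_simps power2_eq_square)
    moreover have "1 - 2 * e\<^sup>2 \<noteq> 0" using e by simp
    ultimately show ?thesis .
  qed
  also have "- (1 - 2 * e\<^sup>2) * I0 + (1 - e\<^sup>2) * (I0 - 2 * e\<^sup>2 * I1) + pi * e\<^sup>2 =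
      e\<^sup>2 * I0 - e\<^sup>2 * (2 * (1 - e\<^sup>2) * I1) + pi * e\<^sup>2"
    by (simp add: algebra_simps)
  also have "\<dots> = 0"
    unfolding rel by (simp add: algebra_simps)
  finally show ?thesis by simp
qed

section \<open>Logarithmic bounds and the limit for e to 0\<close>

lemma arcosh_real_bounds:
  assumes "z \<ge> (1 :: real)"
  shows "ln (2 * z - 1) \<le> arcosh z" "arcosh z \<le> ln (2 * z)"
proof -
  have "z - 1 \<le> sqrt (z\<^sup>2 - 1)"
    using assms by (intro real_le_rsqrt) (simp add: power2_eq_square algebra_simps)
  moreover have "sqrt (z\<^sup>2 - 1) \<le> z"
    using assms by (intro real_le_lsqrt) auto
  ultimately show "ln (2 * z - 1) \<le> arcosh z" "arcosh z \<le> ln (2 * z)"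
    unfolding arcosh_real_def[OF assms] using assms by (auto intro!: ln_mono)
qed

lemma arsinh_real_bounds:
  assumes "y > (0 :: real)"
  shows "ln (2 * y) \<le> arsinh y" "arsinh y \<le> ln (2 * y + 1)"
proof -
  have "y \<le> sqrt (y\<^sup>2 + 1)"
    using assms by (intro real_le_rsqrt) auto
  moreover have "sqrt (y\<^sup>2 + 1) \<le> y + 1"
    using assms by (intro real_le_lsqrt) (auto simp: power2_eq_square algebra_simps)
  ultimately show "ln (2 * y) \<le> arsinh y" "arsinh y \<le> ln (2 * y + 1)"
    unfolding arsinh_real_def using assms by (auto intro!: ln_mono)
qed

lemma integral_bounds_0_pi:
  fixes f :: "real \<Rightarrow> real"
  assumes "f integrable_on {0..pi}" "\<And>x. a \<le> f x" "\<And>x. f x \<le> b"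
  shows "pi * a \<le> integral {0..pi} f" "integral {0..pi} f \<le> pi * b"
  using integral_le[of "\<lambda>_. a" "{0..pi}" f] integral_le[of f "{0..pi}" "\<lambda>_. b"] assms by auto

text \<open>Both integrals diverge, but arcosh behaves like ln (4 / e^2) and arsinh like ln (2 / e),
  so the leading terms of the first and of twice the second cancel, constants included.\<close>

lemma integral_gap_tendsto_0: "(integral_gap \<longlongrightarrow> 0) (at_right 0)"
proof (rule real_tendsto_sandwich)
  \<comment> \<open>\<open>?l\<close> inserts cos x = -1 and \<open>?u\<close> inserts cos x = 1
    into the logarithmic bounds, in both integrands: arcosh enters increasing in cos x, and so does
    minus arsinh.\<close>
  let ?l = "\<lambda>e::real. pi * ln (2 * (2 / e\<^sup>2 - 3) - 1)
    - 2 * (pi * ln (2 * ((1 / e - e + 1) / sqrt (1 - 2 * e\<^sup>2)) + 1)) - pi / 2 * ln (1 - 2 * e\<^sup>2)"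
  let ?u = "\<lambda>e::real. pi * ln (2 * (2 / e\<^sup>2 - 1))
    - 2 * (pi * ln (2 * ((1 / e - e - 1) / sqrt (1 - 2 * e\<^sup>2)))) - pi / 2 * ln (1 - 2 * e\<^sup>2)"
  have "ln (2\<^sup>2 :: real) = 2 * ln 2" by (subst ln_realpow) auto
  then have ln4: "pi * ln 4 - 2 * (pi * ln 2) = 0" by simp
  have "(?l \<longlongrightarrow> pi * ln 4 - 2 * (pi * ln 2)) (at_right 0)" by real_asymp
  then show "(?l \<longlongrightarrow> 0) (at_right 0)" unfolding ln4 .
  have "(?u \<longlongrightarrow> pi * ln 4 - 2 * (pi * ln 2)) (at_right 0)" by real_asymp
  then show "(?u \<longlongrightarrow> 0) (at_right 0)" unfolding ln4 .
  \<comment> \<open>Below 1 / 2 the quantity 1 / e - e - 1 is positive, so the lower bound for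
    arsinh applies.\<close>
  have *: "?l e \<le> integral_gap e \<and> integral_gap e \<le> ?u e" if e: "0 < e" "e < 1 / 2" for e
  proof -
    have "e\<^sup>2 < (1 / 2)\<^sup>2" using e by (intro power_strict_mono) auto
    then have e2: "2 * e\<^sup>2 < 1" by (simp add: power2_eq_square)
    define w where "w = sqrt (1 - 2 * e\<^sup>2)"
    have w: "w > 0" using e2 by (simp add: w_def)
    have "1 / e > 2" using e by (simp add: field_simps)
    then have N: "1 / e - e - 1 > 0" using e by linarith
    have m: "2 / e\<^sup>2 - 2 > 2" "\<And>x. 2 / e\<^sup>2 - 2 + cos x > 1"
      using arcosh_arg_gt_1[OF e(1) e2] by auto
    have bc: "ln (2 * (2 / e\<^sup>2 - 3) - 1) \<le> arcosh (2 / e\<^sup>2 - 2 + cos x)"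
      "arcosh (2 / e\<^sup>2 - 2 + cos x) \<le> ln (2 * (2 / e\<^sup>2 - 1))" for x
    proof -
      define M where "M = 2 / e\<^sup>2"
      have M: "M > 4" using m(1) by (simp add: M_def)
      have z: "M - 2 + cos x \<ge> 1" using m(2)[of x] by (simp add: M_def)
      have "ln (2 * (M - 3) - 1) \<le> ln (2 * (M - 2 + cos x) - 1)"
        by (rule ln_mono) (use M cos_ge_minus_one[of x] in argo)+
      with arcosh_real_bounds(1)[OF z] show "ln (2 * (2 / e\<^sup>2 - 3) - 1) \<le> arcosh (2 / e\<^sup>2 - 2 + cos x)"
        unfolding M_def by (rule order_trans[rotated])
      have "ln (2 * (M - 2 + cos x)) \<le> ln (2 * (M - 1))"
        by (rule ln_mono) (use M z cos_le_one[of x] in argo)+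
      with arcosh_real_bounds(2)[OF z] show "arcosh (2 / e\<^sup>2 - 2 + cos x) \<le> ln (2 * (2 / e\<^sup>2 - 1))"
        unfolding M_def by (rule order_trans)
    qed
    have bs: "ln (2 * ((1 / e - e - 1) / w)) \<le> arsinh ((1 / e - e - cos x) / w)"
      "arsinh ((1 / e - e - cos x) / w) \<le> ln (2 * ((1 / e - e + 1) / w) + 1)" for x
    proof -
      define y where "y = (1 / e - e - cos x) / w"
      have y: "0 < (1 / e - e - 1) / w" "(1 / e - e - 1) / w \<le> y" "y \<le> (1 / e - e + 1) / w"
        using N w cos_ge_minus_one[of x] cos_le_one[of x]
        unfolding y_def by (intro divide_pos_pos divide_right_mono; simp)+
      then have y0: "y > 0" by linarith
      have "ln (2 * ((1 / e - e - 1) / w)) \<le> ln (2 * y)"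
      proof -
        have "ln (2 * p) \<le> ln (2 * y)" if "0 < p" "p \<le> y" for p
          using that by simp
        from this[OF y(1,2)] show ?thesis .
      qed
      with arsinh_real_bounds(1)[OF y0] show "ln (2 * ((1 / e - e - 1) / w)) \<le> arsinh ((1 / e - e - cos x) / w)"
        unfolding y_def by (rule order_trans[rotated])
      have "ln (2 * y + 1) \<le> ln (2 * ((1 / e - e + 1) / w) + 1)"
      proof -
        have "ln (2 * y + 1) \<le> ln (2 * p + 1)" if "y \<le> p" for p
          using that y0 by simp
        from this[OF y(3)] show ?thesis .
      qed
      with arsinh_real_bounds(2)[OF y0] show "arsinh ((1 / e - e - cos x) / w) \<le> ln (2 * ((1 / e - e + 1) / w) + 1)"
        unfolding y_def by (rule order_trans)
    qed
    have ic: "(\<lambda>x. arcosh (2 / e\<^sup>2 - 2 + cos x)) integrable_on {0..pi}"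
      using m(2) by (intro integrable_continuous_real continuous_intros) (auto simp: less_imp_le)
    have ia: "(\<lambda>x. arsinh ((1 / e - e - cos x) / w)) integrable_on {0..pi}"
      using w by (intro integrable_continuous_real continuous_intros) auto
    show ?thesis
      unfolding integral_gap_def arcosh_integral_def arsinh_integral_def
      by (intro conjI diff_mono order_refl mult_left_mono[of _ _ 2] integral_bounds_0_pi[OF ic bc]
          integral_bounds_0_pi[OF ia bs, unfolded w_def]) simp_all
  qed
  have ev: "\<forall>\<^sub>F e in at_right 0. e \<in> {0<..<1/2::real}"
    by (rule eventually_at_right_real) simp
  show "\<forall>\<^sub>F e in at_right 0. ?l e \<le> integral_gap e" "\<forall>\<^sub>F e in at_right 0. integral_gap e \<le> ?u e"
    by (rule eventually_mono[OF ev], rule conjunct1[OF *] conjunct2[OF *]; simp)+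
qed

text \<open>A vanishing derivative makes the gap constant on an interval ending at 0, and the limit
  there determines the constant.\<close>

lemma integral_gap_eq_0:
  assumes e: "0 < e" "2 * e\<^sup>2 < 1"
  shows "integral_gap e = 0"
proof -
  let ?U = "{0<..<sqrt (1 / 2)}"
  have eU: "e \<in> ?U" using e two_power2_less_1_iff[of e] by auto
  have "\<exists>c. \<forall>y\<in>?U. integral_gap y = c"
  proof (rule has_field_derivative_zero_constant)
    fix y :: real assume "y \<in> ?U"
    then have "0 < y" "2 * y\<^sup>2 < 1" using two_power2_less_1_iff[of y] by auto
    then show "(integral_gap has_real_derivative 0) (at y within ?U)"
      by (intro has_field_derivative_at_within[OF integral_gap_has_derivative_0])
  qed auto
  then obtain c where "\<forall>y\<in>?U. integral_gap y = c" by (rule exE)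
  then have const: "integral_gap y = integral_gap e" if "y \<in> ?U" for y
    using that eU by simp
  have "\<forall>\<^sub>F y in at_right 0. y \<in> ?U"
    by (rule eventually_at_right_real) simp
  then have "\<forall>\<^sub>F y in at_right 0. integral_gap y = integral_gap e"
    by (rule eventually_mono) (rule const)
  with integral_gap_tendsto_0 have "((\<lambda>_. integral_gap e) \<longlongrightarrow> 0) (at_right (0::real))"
    by (rule Lim_transform_eventually)
  then show ?thesis
    by (simp add: tendsto_const_iff)
qed

subsection \<open>Jensen's formula and the Mahler measures\<close>

text \<open>Jensen's formula without zeros in the disc: Ln (1 + z) is holomorphic since Re (1 + z) >
  0, so its mean on the circle is its value 0 at the centre.\<close>

lemma has_integral_ln_cmod_one_plus_circle:
  fixes r :: real
  assumes r: "0 < r" "r < 1"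
  shows "((\<lambda>t. ln (cmod (1 + of_real r * cis (2 * pi * t)))) has_integral 0) {0..1}"
proof -
  have nz: "1 + z \<notin> \<real>\<^sub>\<le>\<^sub>0" if "cmod z \<le> r" for z :: complex
  proof -
    have "\<bar>Re z\<bar> \<le> r" using abs_Re_le_cmod[of z] that by linarith
    then have "Re (1 + z) > 0" using r by simp
    then show ?thesis by (auto simp: complex_nonpos_Reals_iff)
  qed
  then have "(\<lambda>z. Ln (1 + z)) holomorphic_on cball 0 r"
    by (auto intro!: holomorphic_intros)
  from Cauchy_integral_circlepath_simple[OF this, of 0] r
  have "((\<lambda>u. Ln (1 + u) / u) has_contour_integral 0) (circlepath 0 r)"
    by simp
  \<comment> \<open>On the circle dz / z = 2 pi i dt, which turns the contour integral into a
    mean.\<close>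
  then have "((\<lambda>t. 2 * pi * \<i> * Ln (1 + of_real r * cis (2 * pi * t))) has_integral 0) {0..1}"
    unfolding has_contour_integral_def
  proof (rule has_integral_eq[rotated])
    fix t :: real assume "t \<in> {0..1}"
    then have v: "vector_derivative (circlepath 0 r) (at t within {0..1}) =
        2 * pi * \<i> * (of_real r * cis (2 * pi * t))"
      by (simp add: vector_derivative_circlepath01 cis_conv_exp mult_ac)
    have p: "circlepath 0 r t = of_real r * cis (2 * pi * t)"
      by (simp add: circlepath cis_conv_exp mult_ac)
    show "Ln (1 + circlepath 0 r t) / circlepath 0 r t *
        vector_derivative (circlepath 0 r) (at t within {0..1}) =
        2 * pi * \<i> * Ln (1 + of_real r * cis (2 * pi * t))"
      unfolding v p using r by simp
  qed
  from has_integral_mult_right[OF this, of "1 / (2 * pi * \<i>)"]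
  have "((\<lambda>t. Ln (1 + of_real r * cis (2 * pi * t))) has_integral 0) {0..1}"
    by simp
  from has_integral_linear[OF this bounded_linear_Re]
  have "((\<lambda>t. Re (Ln (1 + of_real r * cis (2 * pi * t)))) has_integral 0) {0..1}"
    by (simp add: o_def)
  moreover have "1 + of_real r * cis (2 * pi * t) \<noteq> 0" for t
    using nz[of "of_real r * cis (2 * pi * t)"] r by (auto simp: norm_mult)
  ultimately show ?thesis
    by simp
qed

text \<open>With w = arcosh z the argument of ln factors as exp w times the squared modulus of 1 +
  exp (-w) cis x, whose logarithm has mean 0.\<close>

lemma integral_ln_plus_cos:
  fixes z :: real
  assumes z: "z > 1"
  shows "integral {0..1} (\<lambda>t. ln (2 * z + 2 * cos (2 * pi * t))) = arcosh z"
proof -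
  define w where "w = arcosh z"
  have w: "w > 0" using z by (simp add: w_def)
  have z_eq: "2 * z = exp w + exp (- w)"
    using z cosh_arcosh_real[of z] by (simp add: w_def cosh_def)
  have "ln (2 * z + 2 * cos x) = w + 2 * ln (cmod (1 + of_real (exp (- w)) * cis x))" for x
  proof -
    have "(cmod (1 + of_real (exp (- w)) * cis x))\<^sup>2 =
        (1 + exp (- w) * cos x)\<^sup>2 + (exp (- w) * sin x)\<^sup>2"
      by (simp add: cmod_power2)
    also have "\<dots> = 1 + 2 * exp (- w) * cos x + (exp (- w))\<^sup>2 * ((sin x)\<^sup>2 + (cos x)\<^sup>2)"
      by algebra
    also have "\<dots> = exp (- w) * (2 * z + 2 * cos x)"
      unfolding z_eq by (simp add: algebra_simps power2_eq_square flip: exp_add)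
    finally have sq: "(cmod (1 + of_real (exp (- w)) * cis x))\<^sup>2 = exp (- w) * (2 * z + 2 * cos x)" .
    have "z + cos x > 0" using z cos_ge_minus_one[of x] by linarith
    then have pos: "2 * z + 2 * cos x > 0" by simp
    then have "cmod (1 + of_real (exp (- w)) * cis x) > 0"
      using sq by (metis exp_gt_zero mult_pos_pos norm_ge_zero order_le_less power_zero_numeral less_irrefl)
    then have "2 * ln (cmod (1 + of_real (exp (- w)) * cis x)) =
        ln (exp (- w) * (2 * z + 2 * cos x))"
      unfolding sq[symmetric] by (simp add: ln_realpow)
    also have "\<dots> = - w + ln (2 * z + 2 * cos x)"
      using pos by (simp add: ln_mult)
    finally show ?thesis by simp
  qed
  moreover have "((\<lambda>t. w + 2 * ln (cmod (1 + of_real (exp (- w)) * cis (2 * pi * t)))) has_integral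
      (w + 2 * 0)) {0..1}"
    using has_integral_const_real[of w 0 1] w
    by (intro has_integral_add has_integral_mult_right has_integral_ln_cmod_one_plus_circle) auto
  ultimately show ?thesis
    by (simp add: w_def integral_unique)
qed

lemma set_lebesgue_integral_eq_integral_real:
  fixes f :: "real \<Rightarrow> real"
  assumes "continuous_on {a..b} f"
  shows "(LBINT t:{a..b}. f t) = integral {a..b} f"
  by (rule set_borel_integral_eq_integral(2)[OF borel_integrable_atLeastAtMost'[OF assms]])

lemma cis_plus_inverse: "cis x + 1 / cis x = of_real (2 * cos x)"
  by (simp add: complex_eq_iff divide_inverse)

text \<open>For k > 4 the polynomial is real and positive on the torus, so the modulus drops out and
  Jensen's formula evaluates the inner integral.\<close>

lemma mahler_measure_P:
  fixes k :: real
  assumes k: "k > 4"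
  shows "mahler_measure (P 1 (of_real k)) = integral {0..1} (\<lambda>t. arcosh (k / 2 + cos (2 * pi * t)))"
proof -
  have gt: "k / 2 + cos y > 1" for y
    using k cos_ge_minus_one[of y] by linarith
  have pos: "2 * (k / 2 + cos y) + 2 * cos x > 0" for x y
    using gt[of y] cos_ge_minus_one[of x] by argo
  have norm_P: "cmod (P 1 (of_real k) (cis x) (cis y)) = 2 * (k / 2 + cos y) + 2 * cos x" for x y
  proof -
    have "P 1 (of_real k) (cis x) (cis y) = (cis x + 1 / cis x) + (cis y + 1 / cis y) + of_real k"
      by (simp add: P_def)
    also have "\<dots> = of_real (2 * (k / 2 + cos y) + 2 * cos x)"
      unfolding cis_plus_inverse by simp
    finally show ?thesis using pos[of y x] by (simp only: norm_of_real abs_of_pos)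
  qed
  have inner: "(LBINT t1:{0..1}. ln (2 * (k / 2 + cos y) + 2 * cos (2 * pi * t1))) = arcosh (k / 2 + cos y)" for y
  proof -
    have "2 * (k / 2 + cos y) + 2 * cos x \<noteq> 0" for x using pos[of y x] by linarith
    then show ?thesis
      by (subst set_lebesgue_integral_eq_integral_real)
         (intro continuous_intros ballI, assumption, rule integral_ln_plus_cos[OF gt])
  qed
  have "1 \<le> k / 2 + cos y" for y using gt[of y] by simp
  then show ?thesis
    unfolding mahler_measure_def norm_P inner
    by (intro set_lebesgue_integral_eq_integral_real continuous_intros ballI)
qed

text \<open>For these imaginary coefficients B = -2 i sinh u, hence the roots are i exp u and -i exp
  (-u), and the logarithms of their moduli are u and -u.\<close>

lemma half_mahler_diff:
  fixes \<alpha> \<gamma> :: real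
  shows "half_mahler_plus (\<i> * \<alpha>) (- \<i> * \<gamma>) - half_mahler_minus (\<i> * \<alpha>) (- \<i> * \<gamma>) =
    integral {0..1} (\<lambda>t. arsinh (\<gamma> / 2 - \<alpha> * cos (2 * pi * t)))"
proof -
  define u where "u x = arsinh (\<gamma> / 2 - \<alpha> * cos x)" for x
  have B: "B (\<i> * \<alpha>) (- \<i> * \<gamma>) (cis x) = - \<i> * of_real (2 * sinh (u x))" for x
    unfolding B_def cis_plus_inverse by (simp add: u_def algebra_simps)
  \<comment> \<open>Principal branch: the radicand is a negative real and cosh is positive, which
    fixes the sign +i and thereby which root is \<open>y_plus\<close>.\<close>
  have root: "csqrt ((- \<i> * of_real (2 * sinh (u x)))\<^sup>2 - 4) = \<i> * of_real (2 * cosh (u x))" for x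
  proof -
    have eq: "(- \<i> * of_real (2 * sinh (u x)))\<^sup>2 - 4 = of_real (- ((2 * cosh (u x))\<^sup>2))"
      by (simp add: power_mult_distrib cosh_square_eq)
    have "csqrt (of_real (- (y\<^sup>2))) = \<i> * of_real y" if "y \<ge> 0" for y :: real
      using that by (subst csqrt_of_real_nonpos) simp_all
    from this[of "2 * cosh (u x)"] cosh_real_nonneg[of "u x"] show ?thesis
      unfolding eq by (simp only: mult_nonneg_nonneg zero_le_numeral)
  qed
  have plus: "cmod (y_plus (\<i> * \<alpha>) (- \<i> * \<gamma>) (cis x)) = exp (u x)" for x
  proof -
    have "y_plus (\<i> * \<alpha>) (- \<i> * \<gamma>) (cis x) = \<i> * of_real (sinh (u x) + cosh (u x))"
      unfolding y_plus_def B root by (simp add: complex_eq_iff)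
    then show ?thesis by (simp add: norm_mult sinh_plus_cosh del: of_real_add)
  qed
  have minus: "cmod (y_minus (\<i> * \<alpha>) (- \<i> * \<gamma>) (cis x)) = exp (- u x)" for x
  proof -
    have "y_minus (\<i> * \<alpha>) (- \<i> * \<gamma>) (cis x) = - \<i> * of_real (cosh (u x) - sinh (u x))"
      unfolding y_minus_def B root by (simp add: complex_eq_iff)
    then show ?thesis by (simp add: norm_mult cosh_minus_sinh del: of_real_diff)
  qed
  have u: "continuous_on {0..1} (\<lambda>t. u (2 * pi * t))"
    unfolding u_def by (intro continuous_intros)
  have mx: "continuous_on {0..1} (\<lambda>t. max 0 (u (2 * pi * t)))" "continuous_on {0..1} (\<lambda>t. max 0 (- u (2 * pi * t)))"
    by (intro continuous_intros u)+
  have "half_mahler_plus (\<i> * \<alpha>) (- \<i> * \<gamma>) - half_mahler_minus (\<i> * \<alpha>) (- \<i> * \<gamma>) =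
      integral {0..1} (\<lambda>t. max 0 (u (2 * pi * t))) - integral {0..1} (\<lambda>t. max 0 (- u (2 * pi * t)))"
    unfolding half_mahler_plus_def half_mahler_minus_def plus minus log_plus_def ln_exp
    by (simp only: set_lebesgue_integral_eq_integral_real[OF mx(1)] set_lebesgue_integral_eq_integral_real[OF mx(2)])
  also have "\<dots> = integral {0..1} (\<lambda>t. max 0 (u (2 * pi * t)) - max 0 (- u (2 * pi * t)))"
    by (intro integral_diff[symmetric] integrable_continuous_real mx)
  \<comment> \<open>Positive part minus negative part of u is u itself, whatever its sign.\<close>
  also have "\<dots> = integral {0..1} (\<lambda>t. u (2 * pi * t))"
    by (intro integral_cong) (simp add: max_def)
  finally show ?thesis unfolding u_def .
qed

theorem theorem1:
  fixes k :: real and a c :: complex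
  assumes "k > 4"
    and "a = csqrt (of_real ((4 + k) / (4 - k)))"
    and "c = of_real k / csqrt (of_real (4 - k))"
  shows "mahler_measure (P 1 (of_real k)) =
           2 * (half_mahler_plus a c - half_mahler_minus a c) + 1 / 2 * ln ((k - 4) / (k + 4))"
proof -
  define p q where "p = sqrt (k + 4)" and "q = sqrt (k - 4)"
  have pq: "p > 0" "q > 0" "p\<^sup>2 = k + 4" "q\<^sup>2 = k - 4"
    using \<open>k > 4\<close> by (auto simp: p_def q_def)
  \<comment> \<open>This parameter makes 2 / e^2 - 2 equal k / 2 and 1 - 2 e^2 equal (k - 4) / (k +
    4), so both sides become rational in e up to one square root.\<close>
  define e where "e = 2 / p"
  have e2: "e\<^sup>2 = 4 / (k + 4)" using pq by (simp add: e_def power_divide)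
  have e: "0 < e" "2 * e\<^sup>2 < 1"
    using \<open>k > 4\<close> pq by (simp add: e_def, simp add: e2)
  have w: "1 - 2 * e\<^sup>2 = (k - 4) / (k + 4)" "sqrt (1 - 2 * e\<^sup>2) = q / p"
  proof -
    show "1 - 2 * e\<^sup>2 = (k - 4) / (k + 4)" using \<open>k > 4\<close> by (simp add: e2 field_simps)
    then show "sqrt (1 - 2 * e\<^sup>2) = q / p" by (simp add: real_sqrt_divide p_def q_def)
  qed
  \<comment> \<open>Both radicands are negative, so the principal roots carry +i; in c the root is a
    denominator, which turns the sign into -i.\<close>
  have a: "a = \<i> * of_real (p / q)"
  proof -
    have "(4 + k) / (4 - k) = - ((k + 4) / (k - 4))" using \<open>k > 4\<close> by (simp add: field_simps)
    then have "a = \<i> * of_real (sqrt ((k + 4) / (k - 4)))"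
      unfolding assms(2) using \<open>k > 4\<close> by (subst csqrt_of_real_nonpos) auto
    then show ?thesis by (simp add: real_sqrt_divide p_def q_def)
  qed
  have c: "c = - \<i> * of_real (k / q)"
  proof -
    have "csqrt (of_real (4 - k)) = \<i> * of_real q"
      using \<open>k > 4\<close> by (subst csqrt_of_real_nonpos) (auto simp: q_def)
    then show ?thesis unfolding assms(3) using pq by (simp add: field_simps)
  qed
  have k_e: "k / 2 = 2 / e\<^sup>2 - 2" using \<open>k > 4\<close> by (simp add: e2 field_simps)
  have k_q: "(k / q) / 2 - p / q * y = (1 / e - e - y) / sqrt (1 - 2 * e\<^sup>2)" for y
  proof -
    have "1 / e - e = k / (2 * p)"
    proof -
      have "k = p\<^sup>2 - 4" using pq by simp
      then show ?thesis using pq(1) by (simp add: e_def field_simps power2_eq_square)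
    qed
    then show ?thesis unfolding w(2) using pq(1,2) by (simp add: field_simps)
  qed
  have "continuous_on {-1..1} (\<lambda>y. arcosh (2 / e\<^sup>2 - 2 + y))"
    using arcosh_arg_gt_1(1)[OF e] by (intro continuous_intros) auto
  then have lhs: "mahler_measure (P 1 (of_real k)) = arcosh_integral e / pi"
    unfolding mahler_measure_P[OF \<open>k > 4\<close>] k_e arcosh_integral_def by (rule integral_cos_full_circle)
  have "continuous_on {-1..1} (\<lambda>y. arsinh ((1 / e - e - y) / sqrt (1 - 2 * e\<^sup>2)))"
    using e by (intro continuous_intros) auto
  then have rhs: "half_mahler_plus a c - half_mahler_minus a c = arsinh_integral e / pi"
    unfolding a c half_mahler_diff k_q arsinh_integral_def by (rule integral_cos_full_circle)
  have "arcosh_integral e = 2 * arsinh_integral e + pi / 2 * ln ((k - 4) / (k + 4))"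
    using integral_gap_eq_0[OF e] unfolding integral_gap_def w(1) by simp
  then show ?thesis
    unfolding lhs rhs by (simp add: add_divide_distrib)
qed

end
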